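(* Let $G=(N,E)$ be a finite directed graph and let $(i,\xi,u)\in\mathbb R^E_{\ge0}\times\mathbb R^E_{\ge0}\times\mathbb R^N$ be such that $\min_{e\in E}\xi(e)>0$ and $\min\{i,\xi-Du\}=0$ in $E$. Then $$\operatorname{in-diam}_\xi(\{i>0\})\le\operatorname{diam}_\xi(\{\operatorname{div}i>0\},\{\operatorname{div}i<0\}).$$
   Context: A directed graph is $G=(N,E)$ with $N$ finite and $E\subseteq N\times N$; for $e=(x,y)$ write $e^-=x$, $e^+=y$. $Du(e)=u(e^+)-u(e^-)$; $\operatorname{div}i(x)=\sum_{e^-=x}i(e)-\sum_{e^+=x}i(e)$; the minimum in the equation is coordinatewise; $\{f>0\}$ denotes the set where $f$ is positive (similarly $\{f<0\}$). A path is a finite list of nodes $\omega=(x_0,\dots,x_\ell)$, $\ell\ge0$, with $(x_{k-1},x_k)\in E$; $\omega^-=x_0$, $\omega^+=x_\ell$; $\omega\subseteq A$ (for $A\subseteq E$) means all edges of $\omega$ lie in $A$. $L_\xi(\omega)=\sum_{e\in\omega}\xi(e)$ (with multiplicity), $d_\xi(x,y)=\min\{L_\xi(\omega):\omega^-=x,\omega^+=y\}$ ($+\infty$ if there is no such path), and $\operatorname{Geod}(G,\xi)$ is the set of paths with $L_\xi(\omega)=d_\xi(\omega^-,\omega^+)$. For $A\subseteq E$: $\operatorname{in-diam}_\xi(A)=\max\{L_\xi(\omega):\omega\subseteq A,\ \omega\in\operatorname{Geod}(G,\xi)\}$. For $A,B\subseteq N$: $\operatorname{diam}_\xi(A,B)=\max_{x\in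 A,y\in B}d_\xi(x,y)$. *)

theory Defs
  imports "Graph_Theory.Graph_Theory"
begin

text \<open>
  Functions on the edge set (or on the node set) are total functions of which only the values on
  \<open>parcs G\<close> (or \<open>pverts G\<close>) matter.  A path is a library \<open>awalk x p y\<close>: the start node \<open>x\<close>, the list
  \<open>p\<close> of its edges and the end node \<open>y\<close>; this determines its list of nodes, and \<open>p = []\<close> with
  \<open>x = y\<close> is the path of length zero at \<open>x\<close>.  The length \<open>L\<^sub>\<xi>\<close> is the library's \<open>awalk_cost \<xi>\<close>
  and the distance \<open>d\<^sub>\<xi>\<close> is the library's \<open>\<mu> \<xi>\<close>, an infimum in \<open>ereal\<close>, which is \<open>\<infinity>\<close> if there is
  no path.
\<close>

definition grad :: "('a \<Rightarrow> real) \<Rightarrow> 'a \<times> 'a \<Rightarrow> real" where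
  "grad u e = u (snd e) - u (fst e)"

text \<open>
  A maximum of a set of values in \<open>[0, \<infinity>]\<close>; the maximum of the empty set is its least element \<open>0\<close>
  (rather than \<open>-\<infinity>\<close>, the supremum of the empty set in \<open>ereal\<close>).
\<close>
definition max_ext :: "ereal set \<Rightarrow> ereal" where
  "max_ext S = (if S = {} then 0 else Sup S)"

context pair_wf_digraph
begin

definition divergence :: "('a \<times> 'a \<Rightarrow> real) \<Rightarrow> 'a \<Rightarrow> real" where
  "divergence i x = (\<Sum>e\<in>out_arcs G x. i e) - (\<Sum>e\<in>in_arcs G x. i e)"

definition geod :: "('a \<times> 'a \<Rightarrow> real) \<Rightarrow> ('a \<times> ('a \<times> 'a) awalk \<times> 'a) set" where
  "geod \<xi> = {(x, p, y). awalk x p y \<and> ereal (awalk_cost \<xi> p) = \<mu> \<xi> x y}"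

text \<open>
  On a finite graph with positive \<open>\<xi>\<close> geodesics do not repeat nodes, so there are finitely many of
  them and the suprema below are attained.
\<close>

definition in_diam :: "('a \<times> 'a \<Rightarrow> real) \<Rightarrow> ('a \<times> 'a) set \<Rightarrow> ereal" where
  "in_diam \<xi> A =
     max_ext {ereal (awalk_cost \<xi> p) | x p y. set p \<subseteq> A \<and> (x, p, y) \<in> geod \<xi>}"

definition diam :: "('a \<times> 'a \<Rightarrow> real) \<Rightarrow> 'a set \<Rightarrow> 'a set \<Rightarrow> ereal" where
  "diam \<xi> A B = max_ext {\<mu> \<xi> x y | x y. x \<in> A \<and> y \<in> B}"

end

end

theory Submission
  imports Defs
begin

text \<open>
  On the support \<open>R = {i > 0}\<close> the equation forces \<open>Du = \<xi>\<close>, and \<open>Du \<le> \<xi>\<close> everywhere. So a path in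
  \<open>R\<close> from \<open>x\<close> to \<open>y\<close> has length \<open>u y - u x\<close>, while \<open>u z - u w\<close> is a lower bound for the distance
  from \<open>w\<close> to \<open>z\<close>. Among the pairs in the transitive closure of \<open>R\<close> choose one, \<open>(w, z)\<close>, for
  which \<open>u z - u w\<close> is maximal. Since \<open>u\<close> increases strictly along \<open>R\<close>, maximality means that no
  edge of \<open>R\<close> enters \<open>w\<close> or leaves \<open>z\<close>; hence the divergence is positive at \<open>w\<close> and negative at \<open>z\<close>.
\<close>

lemma max_ext_upper: "a \<in> S \<Longrightarrow> a \<le> max_ext S"
  by (auto simp: max_ext_def intro: Sup_upper)

context pair_wf_digraph
begin

text \<open>The gradients of \<open>u\<close> along a walk telescope to \<open>u y - u x\<close>,
  and each is bounded by the length of its edge.\<close>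

lemma potential_diff_le_awalk_cost:
  assumes "awalk x p y" and "\<forall>e\<in>parcs G. grad u e \<le> \<xi> e"
  shows "u y - u x \<le> awalk_cost \<xi> p"
  using assms(1)
proof (induction p arbitrary: x)
  case Nil
  then show ?case by (simp add: awalk_Nil_iff)
next
  case (Cons e p)
  then have "e \<in> parcs G" "x = fst e" "awalk (snd e) p y"
    by (simp_all add: awalk_Cons_iff)
  then show ?case
    using Cons.IH[of "snd e"] assms(2) by (force simp: grad_def)
qed

lemma awalk_cost_eq_potential_diff:
  assumes "awalk x p y" and "\<forall>e\<in>set p. grad u e = \<xi> e"
  shows "awalk_cost \<xi> p = u y - u x"
  using assms
proof (induction p arbitrary: x)
  case Nil
  then show ?case by (simp add: awalk_Nil_iff)
next
  case (Cons e p)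
  then show ?case
    by (force simp: grad_def awalk_Cons_iff)
qed

text \<open>Trades walks, of which there may be infinitely many, for a relation that is finite along
  with \<open>R\<close>, so that a maximal pair exists. The empty walk is excluded because
  \<open>R\<^sup>+\<close> need not be reflexive.\<close>

lemma awalk_imp_trancl:
  assumes "awalk x p y" and "p \<noteq> []" and "set p \<subseteq> R"
  shows "(x, y) \<in> R\<^sup>+"
  using assms
proof (induction p arbitrary: x)
  case (Cons e p)
  then have e: "(x, snd e) \<in> R" and p: "awalk (snd e) p y"
    by (auto simp: awalk_Cons_iff)
  show ?case
  proof (cases "p = []")
    case True
    then show ?thesis using e p by (auto simp: awalk_Nil_iff)
  next
    case False
    then show ?thesis using Cons.IH[OF p] Cons.prems e by (auto intro: trancl_into_trancl2)
  qed
qed simp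

lemma potential_diff_le_distance:
  assumes "\<forall>e\<in>parcs G. grad u e \<le> \<xi> e"
  shows "ereal (u y - u x) \<le> \<mu> \<xi> x y"
  unfolding \<mu>_def using potential_diff_le_awalk_cost[OF _ assms]
  by (auto intro!: INF_greatest)

lemma distance_nonneg:
  assumes "\<forall>e\<in>parcs G. 0 \<le> \<xi> e"
  shows "0 \<le> \<mu> \<xi> x y"
  \<comment> \<open>The zero potential turns the lower bound for the distance into
    nonnegativity.\<close>
  using potential_diff_le_distance[of "\<lambda>_. 0" \<xi> y x] assms by (simp add: grad_def zero_ereal_def)

lemma diam_nonneg:
  assumes "\<forall>e\<in>parcs G. 0 \<le> \<xi> e"
  shows "0 \<le> diam \<xi> A B"
proof (cases "{\<mu> \<xi> x y | x y. x \<in> A \<and> y \<in> B} = {}")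
  case False
  then obtain x y where "x \<in> A" "y \<in> B" by blast
  then have "\<mu> \<xi> x y \<le> diam \<xi> A B"
    unfolding diam_def by (intro max_ext_upper) blast
  then show ?thesis using distance_nonneg[OF assms, of x y] by order
qed (simp add: diam_def max_ext_def)

end

context pair_fin_digraph
begin

text \<open>Nothing flows into \<open>x\<close>, and the outflow is at least \<open>i (x, y)\<close>
  since its other terms are nonnegative.\<close>

lemma divergence_pos:
  assumes "\<forall>e\<in>parcs G. 0 \<le> i e"
    and "(x, y) \<in> parcs G" and "0 < i (x, y)"
    and "\<forall>v. (v, x) \<in> parcs G \<longrightarrow> i (v, x) = 0"
  shows "0 < divergence i x"
proof -
  have "(\<Sum>e\<in>in_arcs G x. i e) = 0"
    using assms(4) by (intro sum.neutral) (auto simp: in_arcs_def)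
  moreover have "0 < (\<Sum>e\<in>out_arcs G x. i e)"
    using assms by (intro sum_pos2[of _ "(x, y)"]) (auto simp: out_arcs_def)
  ultimately show ?thesis by (simp add: divergence_def)
qed

lemma divergence_neg:
  assumes "\<forall>e\<in>parcs G. 0 \<le> i e"
    and "(x, y) \<in> parcs G" and "0 < i (x, y)"
    and "\<forall>v. (y, v) \<in> parcs G \<longrightarrow> i (y, v) = 0"
  shows "divergence i y < 0"
proof -
  have "(\<Sum>e\<in>out_arcs G y. i e) = 0"
    using assms(4) by (intro sum.neutral) (auto simp: out_arcs_def)
  moreover have "0 < (\<Sum>e\<in>in_arcs G y. i e)"
    using assms by (intro sum_pos2[of _ "(x, y)"]) (auto simp: in_arcs_def)
  ultimately show ?thesis by (simp add: divergence_def)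
qed

lemma trancl_support_potential_diff_le_source_sink:
  fixes i :: "'a \<times> 'a \<Rightarrow> real" and u :: "'a \<Rightarrow> real"
  defines "R \<equiv> {e \<in> parcs G. 0 < i e}"
  assumes nonneg: "\<forall>e\<in>parcs G. 0 \<le> i e"
    and incr: "\<forall>e\<in>R. 0 < grad u e"
    and xy: "(x, y) \<in> R\<^sup>+"
  obtains w z where "w \<in> pverts G" "z \<in> pverts G" "0 < divergence i w" "divergence i z < 0"
    "u y - u x \<le> u z - u w"
proof -
  let ?f = "\<lambda>(a, b). u b - u a"
  have "finite R" by (simp add: R_def)
  then have fin: "finite (R\<^sup>+)" by simp
  obtain w z where wz: "(w, z) \<in> R\<^sup>+"
    and "?f (w, z) = Max (?f ` R\<^sup>+)"
    using Max_in[of "?f ` R\<^sup>+"] fin xy by fastforce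
  then have max: "u b - u a \<le> u z - u w" if "(a, b) \<in> R\<^sup>+" for a b
    using Max_ge[OF finite_imageI[OF fin] imageI[OF that, of ?f]] by simp
  \<comment> \<open>Such an edge would extend the pair to \<open>(w, v)\<close> in
    \<open>R\<^sup>+\<close> with \<open>u v > u z\<close>, against maximality.\<close>
  have no_out: "(z, v) \<notin> R" for v
    using max[of w v] wz incr by (force simp: grad_def intro: trancl_into_trancl)
  have no_in: "(v, w) \<notin> R" for v
    using max[of v z] wz incr by (force simp: grad_def intro: trancl_into_trancl2)
  obtain a where a: "(w, a) \<in> R" using wz by (meson tranclD)
  obtain b where b: "(b, z) \<in> R" using wz by (meson tranclD2)
  show thesis
  proof (rule that)
    show "w \<in> pverts G" "z \<in> pverts G"
      using a b by (auto simp: R_def dest: arc_fst_in_verts arc_snd_in_verts)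
    \<comment> \<open>An edge into \<open>w\<close> lies outside \<open>R\<close>, so
      \<open>i\<close> is not positive there; being nonnegative, it vanishes.\<close>
    show "0 < divergence i w"
      using a no_in nonneg by (intro divergence_pos) (force simp: R_def)+
    show "divergence i z < 0"
      using b no_out nonneg by (intro divergence_neg) (force simp: R_def)+
    show "u y - u x \<le> u z - u w" by (rule max[OF xy])
  qed
qed

lemma in_diam_support_le_diam:
  assumes nonneg: "\<forall>e\<in>parcs G. 0 \<le> i e"
    and pos: "\<forall>e\<in>parcs G. 0 < \<xi> e"
    and min0: "\<forall>e\<in>parcs G. min (i e) (\<xi> e - grad u e) = 0"
  shows "in_diam \<xi> {e \<in> parcs G. i e > 0}
    \<le> diam \<xi> {x \<in> pverts G. divergence i x > 0} {x \<in> pverts G. divergence i x < 0}"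
    (is "in_diam \<xi> ?R \<le> ?D")
proof -
  \<comment> \<open>A minimum equal to 0 makes both arguments nonnegative, and where the first is
    positive the second must be 0.\<close>
  have le: "\<forall>e\<in>parcs G. grad u e \<le> \<xi> e"
    using min0 by (metis diff_ge_0_iff_ge min.cobounded2)
  have eq: "\<forall>e\<in>?R. grad u e = \<xi> e"
    using min0 by (force simp: min_def split: if_splits)
  have D0: "0 \<le> ?D" using pos by (intro diam_nonneg) (auto intro: less_imp_le)
  have cost: "ereal (awalk_cost \<xi> p) \<le> ?D" if p: "awalk x p y" "set p \<subseteq> ?R" for x p y
  proof (cases "p = []")
    \<comment> \<open>A walk of length zero yields no edge of the support. If \<open>i\<close>
      vanishes everywhere, both divergence sets are empty and the bound rests on the default value 0
      of \<open>max_ext\<close>.\<close>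
    case True
    then show ?thesis using D0 by (simp add: zero_ereal_def)
  next
    case False
    then have "(x, y) \<in> ?R\<^sup>+" using p by (intro awalk_imp_trancl)
    moreover have "\<forall>e\<in>?R. 0 < grad u e" using eq pos by simp
    ultimately obtain w z where wz: "w \<in> pverts G" "z \<in> pverts G"
      "0 < divergence i w" "divergence i z < 0" "u y - u x \<le> u z - u w"
      using trancl_support_potential_diff_le_source_sink[OF nonneg] by blast
    have "awalk_cost \<xi> p = u y - u x"
      using p eq by (intro awalk_cost_eq_potential_diff) auto
    also have "ereal (u y - u x) \<le> ereal (u z - u w)" using wz by simp
    also have "\<dots> \<le> \<mu> \<xi> w z" by (rule potential_diff_le_distance[OF le])
    also have "\<dots> \<le> ?D"
      unfolding diam_def using wz by (intro max_ext_upper) blast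
    finally show ?thesis .
  qed
  then have "Sup {ereal (awalk_cost \<xi> p) | x p y. set p \<subseteq> ?R \<and> (x, p, y) \<in> geod \<xi>} \<le> ?D"
    by (intro Sup_least) (auto simp: geod_def)
  then show ?thesis using D0 by (simp add: in_diam_def max_ext_def)
qed

end

theorem corollary3p14:
  fixes G :: "'a pair_pre_digraph"
    and i \<xi> :: "'a \<times> 'a \<Rightarrow> real"
    and u :: "'a \<Rightarrow> real"
  assumes "pair_fin_digraph G"
    and "\<forall>e\<in>parcs G. 0 \<le> i e"
    and "\<forall>e\<in>parcs G. 0 \<le> \<xi> e"
    and "\<forall>e\<in>parcs G. 0 < \<xi> e"
    and "\<forall>e\<in>parcs G. min (i e) (\<xi> e - grad u e) = 0"
  shows "pair_wf_digraph.in_diam G \<xi> {e \<in> parcs G. i e > 0}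
    \<le> pair_wf_digraph.diam G \<xi>
        {x \<in> pverts G. pair_wf_digraph.divergence G i x > 0}
        {x \<in> pverts G. pair_wf_digraph.divergence G i x < 0}"
  using pair_fin_digraph.in_diam_support_le_diam[OF assms(1,2,4,5)] .

end
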